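(* For every $\epsilon>0$ there exists $N_\epsilon$ such that, for every integer $n\geq N_\epsilon$ and every $z=(z_1,\ldots,z_n)\in\mathbb C^n$ satisfying $|z_j|\geq 1$ for $1\leq j\leq n$, $$M_n(z)\geq \frac1n\exp\!\left[-\sqrt n\left(\log n+\log\frac{2}{\log 2}+\epsilon\right)\right].$$ In particular, $M_n(z)\geq \exp\bigl(-(1+o(1))\sqrt n\log n\bigr)$ as $n\to\infty$, uniformly over such configurations; that is, there is a real sequence $\eta_n\to 0$, not depending on $z$, such that for all sufficiently large $n$ and all $z\in\mathbb C^n$ with $|z_j|\ge 1$ for $1\le j\le n$, one has $M_n(z)\geq \exp\bigl(-(1+\eta_n)\sqrt n\log n\bigr)$.
   Context: For $z=(z_1,\ldots,z_n)\in\mathbb C^n$, put $p_k(z)=\sum_{j=1}^n z_j^k$ and $M_n(z)=\max_{2\leq k\leq n+1}|p_k(z)|$, the maximum being over integers $k$. $\log$ is the natural logarithm. *)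

theory Defs
  imports Complex_Main
begin

text \<open>
  A vector \<open>z = (z\<^sub>1, \<dots>, z\<^sub>n)\<close> of complex numbers is represented by a function
  \<open>z :: nat \<Rightarrow> complex\<close>, of which only the values at \<open>1, \<dots>, n\<close> are used; \<open>n\<close> cannot be a
  type-level dimension because the statement quantifies over it.
\<close>

definition power_sum :: "nat \<Rightarrow> (nat \<Rightarrow> complex) \<Rightarrow> nat \<Rightarrow> complex" where
  "power_sum n z k = (\<Sum>j=1..n. z j ^ k)"

text \<open>Only meaningful for \<open>n \<ge> 1\<close>: for \<open>n = 0\<close> the range of \<open>k\<close> is empty.\<close>

definition max_power_sum :: "nat \<Rightarrow> (nat \<Rightarrow> complex) \<Rightarrow> real" where
  "max_power_sum n z = Max ((\<lambda>k. cmod (power_sum n z k)) ` {2..n+1})"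

end

theory Submission
  imports
    Defs
    "HOL-Complex_Analysis.Conformal_Mappings"
    "HOL-Computational_Algebra.Polynomial_FPS"
    "HOL-Real_Asymp.Real_Asymp"
begin

text \<open>
  Let \<open>\<delta>\<close> be the maximum of \<open>\<bar>p\<^sub>k\<bar>\<close> over \<open>2 \<le> k \<le> n + 1\<close>, let \<open>P(x) = \<Prod>\<^sub>j (1 - z\<^sub>j x)\<close> and
  \<open>s = -p\<^sub>1\<close>. Newton's identities say that \<open>P' - s P\<close> involves only \<open>p\<^sub>2, \<dots>, p\<^sub>n\<^sub>+\<^sub>1\<close>, so it is
  tiny when \<open>\<delta>\<close> is: \<open>P\<close> wants to be the exponential function \<open>exp (s x)\<close>. On the other hand, the
  zeros \<open>1 / z\<^sub>j\<close> of \<open>P\<close> lie in the closed unit disc, so \<open>P' / P\<close> is holomorphic outside that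
  disc and behaves like \<open>n / x\<close> at infinity. A function cannot be almost equal to the nonzero constant
  \<open>s\<close> on a part of the outer region and vanish at infinity.

  To make this quantitative, take a point \<open>x\<^sub>0\<close> at which \<open>\<bar>P\<bar>\<close> is maximal on the circle
  \<open>\<bar>x\<bar> = R = 1 + 1 / L\<close>. By Cauchy's estimate the coefficients of \<open>P\<close> are bounded by \<open>\<bar>P(x\<^sub>0)\<bar>\<close>,
  hence so is \<open>P' - s P\<close>, up to the factor \<open>2 n\<^sup>2 \<delta> R\<^sup>n\<close> (\<open>norm_defect_le\<close>). Within
  distance \<open>O(1 / L)\<close> of \<open>x\<^sub>0\<close> the polynomial \<open>P\<close> is smaller than at \<open>x\<^sub>0\<close> by a factor of at most
  \<open>exp (O(n / L))\<close> (\<open>norm_poly_ge_near_max\<close>), because \<open>\<bar>s\<bar> \<le> 2 n\<close>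
  (\<open>norm_first_power_sum_le\<close>). So \<open>P' / P - s\<close> is at most \<open>\<eta> = \<delta> n\<^sup>2 exp (O(n / L))\<close> on an
  arc around \<open>x\<^sub>0\<close> of length of order \<open>1 / L\<close>, while it is \<open>O(n L)\<close> on the whole circle. Multiplying
  its \<open>L\<close> rotations by multiples of \<open>2 \<pi> / L\<close> spreads the smallness over the whole circle, and the
  maximum principle in the variable \<open>y = 1 / x\<close> yields
  \<open>\<bar>s\<bar>\<^sup>L \<le> \<eta> (O(n L))\<^sup>L\<^sup>-\<^sup>1\<close> (\<open>rotation_product_bound\<close>). Finally \<open>\<bar>s\<bar> \<ge> n / 4\<close>, since
  \<open>x P' / P\<close> has real part at least \<open>n / 2\<close> outside the unit disc. Therefore
  \<open>\<delta> \<ge> n\<^sup>-\<^sup>2 exp (- O(n / L)) (O(L))\<^sup>-\<^sup>L\<close>; this is \<open>power_sums_lower_bound\<close>.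

  With \<open>L\<close> about \<open>sqrt n\<close> the last factor is \<open>exp (- (1/2 + o(1)) sqrt n log n)\<close> and the other
  two are at least \<open>exp (- O(sqrt n))\<close>. So \<open>\<delta> \<ge> exp (- sqrt n log n)\<close> for large \<open>n\<close>, which
  implies both parts of the theorem, the second one with \<open>\<eta>\<^sub>n = 0\<close>.
\<close>

section \<open>The polynomial of the configuration and Newton's identities\<close>

definition recip_poly :: "nat \<Rightarrow> (nat \<Rightarrow> complex) \<Rightarrow> complex poly" where
  "recip_poly n z = (\<Prod>j=1..n. [:1, - z j:])"

lemma recip_poly_Suc: "recip_poly (Suc n) z = recip_poly n z * [:1, - z (Suc n):]"
  by (simp add: recip_poly_def)

lemma poly_recip_poly: "poly (recip_poly n z) x = (\<Prod>j=1..n. 1 - z j * x)"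
  by (simp add: recip_poly_def poly_prod algebra_simps)

lemma coeff_0_recip_poly [simp]: "coeff (recip_poly n z) 0 = 1"
  using poly_recip_poly[of n z 0] by (simp add: poly_0_coeff_0)

lemma degree_recip_poly: "degree (recip_poly n z) \<le> n"
proof (induction n)
  case 0
  show ?case by (simp add: recip_poly_def)
next
  case (Suc n)
  have "degree (recip_poly (Suc n) z) \<le> degree (recip_poly n z) + degree [:1, - z (Suc n):]"
    unfolding recip_poly_Suc by (rule degree_mult_le)
  also have "\<dots> \<le> n + 1"
    using Suc.IH by (intro add_mono) auto
  finally show ?case by simp
qed

text \<open>
  This is the logarithmic derivative of the product, each factor \<open>1 - z\<^sub>j x\<close> contributing the
  geometric series \<open>- z\<^sub>j / (1 - z\<^sub>j x)\<close>; in the ring of formal power series, comparing coefficients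
  turns it into Newton's identities.
\<close>
lemma fps_deriv_recip_poly:
  "fps_deriv (fps_of_poly (recip_poly n z)) =
     - (fps_of_poly (recip_poly n z) * Abs_fps (\<lambda>l. power_sum n z (Suc l)))"
proof (induction n)
  case 0
  show ?case by (simp add: recip_poly_def power_sum_def fps_eq_iff fps_mult_nth)
next
  case (Suc n)
  define w where "w = z (Suc n)"
  define G where "G = Abs_fps (\<lambda>l. w ^ Suc l)"
  define S where "S = Abs_fps (\<lambda>l. power_sum n z (Suc l))"
  define F where "F = fps_of_poly (recip_poly n z)"
  define B where "B = (1 - fps_const w * fps_X :: complex fps)"
  have BG: "B * G = fps_const w"
  proof (rule fps_ext)
    fix k show "fps_nth (B * G) k = fps_nth (fps_const w) k"
      by (cases k) (simp_all add: B_def G_def left_diff_distrib mult.assoc)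
  qed
  have dB: "fps_deriv B = - fps_const w" by (simp add: B_def)
  have S': "Abs_fps (\<lambda>l. power_sum (Suc n) z (Suc l)) = S + G"
    by (rule fps_ext) (simp add: S_def G_def power_sum_def w_def)
  have F': "fps_of_poly (recip_poly (Suc n) z) = F * B"
    by (simp add: recip_poly_Suc fps_of_poly_mult F_def B_def fps_of_poly_linear' w_def
        flip: fps_const_neg)
  have "fps_deriv (F * B) = - (F * S) * B - F * fps_const w"
    using Suc.IH by (simp add: fps_deriv_mult dB F_def S_def algebra_simps)
  also have "\<dots> = - (F * B * (S + G))"
    by (simp add: algebra_simps flip: BG)
  finally show ?case unfolding F' S' .
qed

lemma Newton_identity:
  "of_nat (Suc k) * coeff (recip_poly n z) (Suc k) =
     - (\<Sum>i\<le>k. coeff (recip_poly n z) i * power_sum n z (Suc k - i))"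
proof -
  have "fps_nth (fps_deriv (fps_of_poly (recip_poly n z))) k =
     fps_nth (- (fps_of_poly (recip_poly n z) * Abs_fps (\<lambda>l. power_sum n z (Suc l)))) k"
    by (simp only: fps_deriv_recip_poly)
  then show ?thesis
    by (simp add: fps_mult_nth atLeast0AtMost Suc_diff_le del: of_nat_Suc)
qed

lemma poly_pderiv_recip_poly:
  assumes "\<And>j. j \<in> {1..n} \<Longrightarrow> z j * x \<noteq> 1"
  shows "poly (pderiv (recip_poly n z)) x =
           poly (recip_poly n z) x * (\<Sum>j=1..n. - z j / (1 - z j * x))"
  using assms
proof (induction n)
  case 0
  show ?case by (simp add: recip_poly_def)
next
  case (Suc n)
  have IH: "poly (pderiv (recip_poly n z)) x =
           poly (recip_poly n z) x * (\<Sum>j=1..n. - z j / (1 - z j * x))"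
    by (rule Suc.IH) (use Suc.prems in auto)
  have ne: "1 - z (Suc n) * x \<noteq> 0" using Suc.prems[of "Suc n"] by auto
  have "pderiv [:1, - z (Suc n):] = [:- z (Suc n):]"
    by (simp add: pderiv_pCons)
  then have "poly (pderiv (recip_poly (Suc n) z)) x =
     poly (recip_poly n z) x * (\<Sum>j=1..n. - z j / (1 - z j * x)) * (1 - z (Suc n) * x)
     - poly (recip_poly n z) x * z (Suc n)"
    unfolding recip_poly_Suc pderiv_mult by (simp add: IH algebra_simps)
  also have "\<dots> = poly (recip_poly n z) x * (1 - z (Suc n) * x) *
       ((\<Sum>j=1..n. - z j / (1 - z j * x)) + - z (Suc n) / (1 - z (Suc n) * x))"
    using ne by (simp add: field_simps)
  also have "\<dots> = poly (recip_poly (Suc n) z) x * (\<Sum>j=1..Suc n. - z j / (1 - z j * x))"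
    by (simp add: recip_poly_Suc algebra_simps)
  finally show ?case .
qed

section \<open>Analytic tools\<close>

lemma Cauchy_coeff_bound:
  fixes p :: "complex poly"
  assumes "R > 0" and "\<And>x. cmod x = R \<Longrightarrow> cmod (poly p x) \<le> M"
  shows "cmod (coeff p k) * R ^ k \<le> M"
proof -
  have "(deriv ^^ k) (poly p) = poly ((pderiv ^^ k) p)"
  proof (induction k)
    case (Suc k)
    have "(deriv ^^ Suc k) (poly p) = deriv (poly ((pderiv ^^ k) p))"
      by (simp add: Suc.IH)
    also have "\<dots> = poly ((pderiv ^^ Suc k) p)"
      by (auto intro!: DERIV_imp_deriv poly_DERIV)
    finally show ?case .
  qed simp
  then have "(deriv ^^ k) (poly p) 0 = fact k * coeff p k"
    by (simp add: poly_0_coeff_0 coeff_higher_pderiv pochhammer_fact)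
  moreover have "cmod ((deriv ^^ k) (poly p) 0) \<le> fact k * M / R ^ k"
    using assms by (intro Cauchy_inequality) (auto intro!: holomorphic_intros continuous_intros)
  ultimately show ?thesis
    using \<open>R > 0\<close> by (simp add: norm_mult field_simps)
qed

text \<open>
  An elementary form of the two-constants theorem. The rotations of \<open>f\<close> by the multiples of
  \<open>2 \<pi> / L\<close> are multiplied. At every point of the circle \<open>\<bar>y\<bar> = r\<close> one of the \<open>L\<close> factors is
  evaluated on the short arc where \<open>f\<close> is small, and the maximum principle carries the resulting
  bound to the centre, where all factors are equal to \<open>f 0\<close>.
\<close>
lemma rotation_product_bound:
  fixes f :: "complex \<Rightarrow> complex"
  assumes holo: "f holomorphic_on cball 0 r" and r: "r > 0" and L: "L \<ge> 1"
    and K: "\<And>y. cmod y = r \<Longrightarrow> cmod (f y) \<le> K"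
    and y0: "cmod y0 = r"
    and small: "\<And>y. cmod y = r \<Longrightarrow> cmod (y - y0) \<le> 2 * pi * r / L \<Longrightarrow> cmod (f y) \<le> e"
  shows "cmod (f 0) ^ L \<le> e * K ^ (L - 1)"
proof -
  define c where "c = (\<lambda>l::nat. exp (\<i> * of_real (2 * pi * l / L)))"
  have c1 [simp]: "cmod (c l) = 1" for l
    unfolding c_def by simp
  define H where "H = (\<lambda>y. \<Prod>l<L. f (y * c l))"
  have "cmod (H 0) \<le> e * K ^ (L - 1)"
  proof (rule maximum_modulus_frontier[where S = "cball 0 r" and f = H and \<xi> = 0])
    have hH: "H holomorphic_on cball 0 r"
      unfolding H_def
    proof (intro holomorphic_on_prod)
      fix l
      have "(f \<circ> (\<lambda>y. y * c l)) holomorphic_on cball 0 r"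
        by (rule holomorphic_on_compose_gen[OF _ holo])
           (auto intro!: holomorphic_intros simp: norm_mult)
      then show "(\<lambda>y. f (y * c l)) holomorphic_on cball 0 r" by (simp add: o_def)
    qed
    show "H holomorphic_on interior (cball 0 r)"
      using hH by (rule holomorphic_on_subset) (rule interior_subset)
    show "continuous_on (closure (cball 0 r)) H"
      using hH by (simp add: holomorphic_on_imp_continuous_on)
    show "bounded (cball (0::complex) r)" "0 \<in> cball (0::complex) r" using r by auto
    fix y :: complex assume "y \<in> frontier (cball 0 r)"
    then have y: "cmod y = r" using r by simp
    define a where "a = Arg2pi (y0 / y)"
    have a: "0 \<le> a" "a < 2 * pi" "y0 = y * exp (\<i> * of_real a)"
      using Arg2pi[of "y0 / y"] y y0 r
      by (auto simp: a_def is_Arg_def norm_divide field_simps)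
    \<comment> \<open>The rotation by \<open>2 \<pi> m / L\<close> takes \<open>y\<close> to within one step of \<open>y0\<close>.\<close>
    define m where "m = nat \<lfloor>a * L / (2 * pi)\<rfloor>"
    have x0: "0 \<le> a * L / (2 * pi)" using a by simp
    have "real m = of_int \<lfloor>a * L / (2 * pi)\<rfloor>"
      unfolding m_def using x0 by simp
    then have m: "real m \<le> a * L / (2 * pi)" "a * L / (2 * pi) < real m + 1"
      by linarith+
    have "a * L / (2 * pi) < L" using a L by (simp add: field_simps)
    then have mL: "m < L" using m(1) by linarith
    have d: "\<bar>2 * pi * m / L - a\<bar> \<le> 2 * pi / L"
    proof -
      have "2 * pi * m / L \<le> a" "a < 2 * pi * (m + 1) / L"
        using m L by (simp_all add: field_simps)
      then show ?thesis by (simp add: add_divide_distrib distrib_left)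
    qed
    have "y * c m - y0 = y * exp (\<i> * of_real a) * (exp (\<i> * of_real (2 * pi * m / L - a)) - 1)"
      unfolding c_def a(3) by (simp add: algebra_simps flip: exp_add)
    then have "cmod (y * c m - y0) = r * (2 * \<bar>sin ((2 * pi * m / L - a) / 2)\<bar>)"
      by (simp only: norm_mult dist_exp_i_1 y norm_exp_i_times mult_1_right)
    also have "\<dots> \<le> r * \<bar>2 * pi * m / L - a\<bar>"
      using abs_sin_x_le_abs_x[of "(2 * pi * m / L - a) / 2"] r by (intro mult_left_mono) auto
    also have "\<dots> \<le> r * (2 * pi / L)"
      using d r by (intro mult_left_mono) auto
    finally have "cmod (f (y * c m)) \<le> e"
      by (intro small) (auto simp: norm_mult y mult_ac)
    moreover from this have "0 \<le> e"
      by (rule order_trans[OF norm_ge_zero])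
    moreover have "(\<Prod>l\<in>{..<L} - {m}. cmod (f (y * c l))) \<le> (\<Prod>l\<in>{..<L} - {m}. K)"
      by (intro prod_mono) (auto intro!: K simp: norm_mult y)
    ultimately have "cmod (f (y * c m)) * (\<Prod>l\<in>{..<L} - {m}. cmod (f (y * c l)))
        \<le> e * (\<Prod>l\<in>{..<L} - {m}. K)"
      by (intro mult_mono) (auto intro!: prod_nonneg)
    then show "cmod (H y) \<le> e * K ^ (L - 1)"
      using mL by (simp add: H_def prod.remove[of _ m] norm_mult flip: prod_norm)
  qed
  then show ?thesis by (simp add: H_def norm_power)
qed

text \<open>
  If \<open>p' - s p\<close> is small then \<open>p\<close> is close to \<open>p(x0) exp (s (x - x0))\<close> near \<open>x0\<close>: the quotient
  of the two has a small derivative. In particular \<open>p\<close> decays no faster than this exponential.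
\<close>
lemma norm_poly_ge_near_max:
  fixes p :: "complex poly"
  assumes defect: "\<And>x. cmod x \<le> R \<Longrightarrow> cmod (poly (pderiv p) x - s * poly p x) \<le> e * M"
    and x0: "cmod x0 \<le> R" "cmod (poly p x0) = M"
    and x: "cmod x \<le> R" "cmod (x - x0) \<le> d"
    and e: "0 \<le> e" "e * d * exp (cmod s * d) \<le> 1 / 2"
  shows "M * exp (- (cmod s * d)) / 2 \<le> cmod (poly p x)"
proof -
  define f where "f = (\<lambda>x. poly p x * exp (- (s * (x - x0))))"
  have M0: "0 \<le> M" using x0(2) by auto
  have d0: "0 \<le> d" using x(2) norm_ge_zero order_trans by blast
  have exp_le: "cmod (exp (- (s * (y - x0)))) \<le> exp (cmod s * d)" if "cmod (y - x0) \<le> d" for y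
  proof -
    have "cmod (exp (- (s * (y - x0)))) \<le> exp (cmod (- (s * (y - x0))))" by (rule norm_exp)
    also have "\<dots> \<le> exp (cmod s * d)" using that by (simp add: norm_mult mult_left_mono)
    finally show ?thesis .
  qed
  have "cmod (f x - f x0) \<le> (e * M * exp (cmod s * d)) * cmod (x - x0)"
  proof (rule field_differentiable_bound)
    show "convex (cball 0 R \<inter> cball x0 d)" by (intro convex_Int convex_cball)
    show "(f has_field_derivative
        (poly (pderiv p) y - s * poly p y) * exp (- (s * (y - x0)))) (at y within cball 0 R \<inter> cball x0 d)" for y
      unfolding f_def by (auto intro!: derivative_eq_intros simp: algebra_simps)
    show "cmod ((poly (pderiv p) y - s * poly p y) * exp (- (s * (y - x0)))) \<le> e * M * exp (cmod s * d)"
      if "y \<in> cball 0 R \<inter> cball x0 d" for y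
      unfolding norm_mult using that e M0
      by (intro mult_mono defect exp_le) (auto simp: dist_norm norm_minus_commute)
    show "x \<in> cball 0 R \<inter> cball x0 d" "x0 \<in> cball 0 R \<inter> cball x0 d"
      using x x0 d0 by (auto simp: dist_norm norm_minus_commute)
  qed
  also have "\<dots> \<le> (e * M * exp (cmod s * d)) * d"
    using x e M0 by (intro mult_left_mono) auto
  also have "\<dots> = (e * d * exp (cmod s * d)) * M" by simp
  also have "\<dots> \<le> 1 / 2 * M" using e M0 by (intro mult_right_mono)
  finally have "cmod (f x - f x0) \<le> M / 2" by simp
  moreover have "cmod (f x0) = M" using x0 by (simp add: f_def)
  ultimately have "M / 2 \<le> cmod (f x)"
    using norm_triangle_ineq2[of "f x0" "f x"] by (simp add: norm_minus_commute)
  also have "\<dots> \<le> cmod (poly p x) * exp (cmod s * d)"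
    unfolding f_def norm_mult using exp_le[OF x(2)] by (intro mult_left_mono) auto
  finally show ?thesis by (simp add: exp_minus field_simps)
qed

section \<open>Small power sums make the polynomial almost exponential\<close>

text \<open>
  Writing Newton's identity as a recurrence for the coefficients, the term with \<open>p\<^sub>1\<close> is the only one
  that does not occur on the right-hand side.
\<close>
lemma coeff_defect:
  "coeff (pderiv (recip_poly n z) + smult (power_sum n z 1) (recip_poly n z)) k =
     - (\<Sum>i<k. coeff (recip_poly n z) i * power_sum n z (Suc k - i))"
proof -
  have "{..k} = insert k {..<k}" by auto
  then show ?thesis
    by (simp add: coeff_pderiv Newton_identity del: of_nat_Suc)
qed

lemma norm_coeff_defect_le:
  assumes ps: "\<forall>k\<in>{2..n+1}. cmod (power_sum n z k) \<le> \<delta>"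
    and "k \<le> n"
  shows "cmod (coeff (pderiv (recip_poly n z) + smult (power_sum n z 1) (recip_poly n z)) k)
           \<le> \<delta> * (\<Sum>i<k. cmod (coeff (recip_poly n z) i))"
proof -
  have "cmod (\<Sum>i<k. coeff (recip_poly n z) i * power_sum n z (Suc k - i))
      \<le> (\<Sum>i<k. cmod (coeff (recip_poly n z) i * power_sum n z (Suc k - i)))"
    by (rule norm_sum)
  also have "\<dots> \<le> (\<Sum>i<k. \<delta> * cmod (coeff (recip_poly n z) i))"
  proof (rule sum_mono)
    fix i assume "i \<in> {..<k}"
    then have "cmod (power_sum n z (Suc k - i)) \<le> \<delta>"
      using \<open>k \<le> n\<close> by (intro ps[rule_format]) auto
    then have "cmod (power_sum n z (Suc k - i)) * cmod (coeff (recip_poly n z) i)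
        \<le> \<delta> * cmod (coeff (recip_poly n z) i)"
      by (rule mult_right_mono) simp
    then show "cmod (coeff (recip_poly n z) i * power_sum n z (Suc k - i))
        \<le> \<delta> * cmod (coeff (recip_poly n z) i)"
      by (simp only: norm_mult mult.commute)
  qed
  finally show ?thesis
    unfolding coeff_defect norm_minus_cancel sum_distrib_left .
qed

text \<open>
  The bound is relative to the maximum \<open>M\<close> of \<open>\<bar>P\<bar>\<close> on the circle of radius \<open>R\<close>, so that it remains
  useful at the points where \<open>\<bar>P\<bar>\<close> is comparable to \<open>M\<close>. The factor \<open>R\<^sup>n\<close> is the price for
  estimating the \<open>k\<close>-th coefficient of the defect, which has weight \<open>R\<^sup>k\<close>, by coefficients of \<open>P\<close> of
  smaller index \<open>i\<close>, for which Cauchy's estimate only offers \<open>R\<^sup>i\<close>.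
\<close>
lemma norm_defect_le:
  assumes ps: "\<forall>k\<in>{2..n+1}. cmod (power_sum n z k) \<le> \<delta>"
    and "n \<ge> 1" and R: "R \<ge> 1"
    and M: "\<And>x. cmod x = R \<Longrightarrow> cmod (poly (recip_poly n z) x) \<le> M"
    and x: "cmod x \<le> R"
  shows "cmod (poly (pderiv (recip_poly n z)) x + power_sum n z 1 * poly (recip_poly n z) x)
           \<le> 2 * (real n)\<^sup>2 * \<delta> * R ^ n * M"
proof -
  define a where "a = coeff (recip_poly n z)"
  define E where "E = pderiv (recip_poly n z) + smult (power_sum n z 1) (recip_poly n z)"
  have \<delta>0: "0 \<le> \<delta>"
    by (rule order_trans[OF norm_ge_zero ps[rule_format, of 2]]) (use \<open>n \<ge> 1\<close> in auto)
  have aM: "cmod (a i) * R ^ i \<le> M" for i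
    unfolding a_def using R M by (intro Cauchy_coeff_bound) auto
  have M0: "0 \<le> M" using order_trans[OF norm_ge_zero aM[of 0, simplified]] .
  have term_le: "cmod (coeff E k * x ^ k) \<le> \<delta> * (real n * (M * R ^ n))" if "k \<le> n" for k
  proof -
    have "cmod (coeff E k * x ^ k) \<le> (\<delta> * (\<Sum>i<k. cmod (a i))) * R ^ k"
      unfolding norm_mult norm_power E_def a_def
      using norm_coeff_defect_le[OF ps that] x \<delta>0
      by (intro mult_mono power_mono mult_nonneg_nonneg sum_nonneg) simp_all
    also have "\<dots> = \<delta> * (\<Sum>i<k. cmod (a i) * R ^ k)"
      by (simp add: sum_distrib_right mult.assoc)
    also have "(\<Sum>i<k. cmod (a i) * R ^ k) \<le> (\<Sum>i<k. M * R ^ n)"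
    proof (rule sum_mono)
      fix i assume "i \<in> {..<k}"
      then have "cmod (a i) * R ^ k = cmod (a i) * R ^ i * R ^ (k - i)"
        by (simp flip: power_add)
      also have "\<dots> \<le> M * R ^ n"
        using aM[of i] R M0 that by (intro mult_mono power_increasing) auto
      finally show "cmod (a i) * R ^ k \<le> M * R ^ n" .
    qed
    also have "\<dots> \<le> real n * (M * R ^ n)"
      using that M0 R by (simp add: mult_right_mono)
    finally show ?thesis using \<delta>0 by (simp add: mult_left_mono)
  qed
  have "degree E \<le> n"
    unfolding E_def using degree_recip_poly[of n z]
    by (intro degree_add_le) (simp_all add: degree_pderiv)
  then have "poly E x = (\<Sum>k\<le>n. coeff E k * x ^ k)"
    unfolding poly_altdef by (intro sum.mono_neutral_left) (auto simp: coeff_eq_0)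
  also have "cmod \<dots> \<le> (\<Sum>k\<le>n. \<delta> * (real n * (M * R ^ n)))"
    by (rule sum_norm_le) (use term_le in auto)
  also have "\<dots> = (real n + 1) * (real n * (\<delta> * (M * R ^ n)))" by simp
  also have "\<dots> \<le> (2 * real n) * (real n * (\<delta> * (M * R ^ n)))"
    using \<open>n \<ge> 1\<close> M0 \<delta>0 R by (intro mult_right_mono) auto
  finally have "cmod (poly E x) \<le> (2 * real n) * (real n * (\<delta> * (M * R ^ n)))" .
  then show ?thesis
    by (simp add: E_def power2_eq_square mult_ac)
qed

text \<open>
  The numbers \<open>z\<^sub>j\<close> may be arbitrarily large, so this needs the smallness of the other power sums.
  Newton's recurrence at the largest coefficient \<open>a\<^sub>k\<close> of \<open>P\<close> expresses \<open>p\<^sub>1 a\<^sub>k\<close> by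
  \<open>(k + 1) a\<^sub>k\<^sub>+\<^sub>1\<close> and small multiples of other coefficients, all of them at most \<open>\<bar>a\<^sub>k\<bar>\<close> in absolute
  value; for \<open>k = n\<close> the coefficient \<open>a\<^sub>k\<^sub>+\<^sub>1\<close> is zero.
\<close>
lemma norm_first_power_sum_le:
  assumes ps: "\<forall>k\<in>{2..n+1}. cmod (power_sum n z k) \<le> \<delta>"
    and "n \<ge> 1"
  shows "cmod (power_sum n z 1) \<le> real n * (1 + \<delta>)"
proof -
  define a where "a = coeff (recip_poly n z)"
  have \<delta>0: "0 \<le> \<delta>"
    by (rule order_trans[OF norm_ge_zero ps[rule_format, of 2]]) (use \<open>n \<ge> 1\<close> in auto)
  obtain k where k: "k \<le> n" "\<And>i. i \<le> n \<Longrightarrow> cmod (a i) \<le> cmod (a k)"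
  proof -
    have "Max ((\<lambda>i. cmod (a i)) ` {..n}) \<in> (\<lambda>i. cmod (a i)) ` {..n}"
      by (rule Max_in) auto
    then obtain k where "k \<in> {..n}" "Max ((\<lambda>i. cmod (a i)) ` {..n}) = cmod (a k)"
      by (rule imageE)
    moreover have "cmod (a i) \<le> Max ((\<lambda>i. cmod (a i)) ` {..n})" if "i \<le> n" for i
      using that by (intro Max_ge) auto
    ultimately show ?thesis by (intro that[of k]) auto
  qed
  have ak: "1 \<le> cmod (a k)" using k(2)[of 0] by (simp add: a_def)
  have step: "of_nat (Suc k) * cmod (a (Suc k)) \<le> real n * cmod (a k)"
  proof (cases "k = n")
    case True
    then have "a (Suc k) = 0"
      unfolding a_def using degree_recip_poly[of n z] by (intro coeff_eq_0) simp
    then show ?thesis by simp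
  next
    case False
    then show ?thesis using k by (intro mult_mono) auto
  qed
  have "(\<Sum>i<k. cmod (a i)) \<le> (\<Sum>i<k. cmod (a k))"
    using k by (intro sum_mono) auto
  also have "\<dots> \<le> real n * cmod (a k)" using k(1) by (simp add: mult_right_mono)
  finally have sum_le: "(\<Sum>i<k. cmod (a i)) \<le> real n * cmod (a k)" .
  have "cmod (of_nat (Suc k) * a (Suc k) + power_sum n z 1 * a k) \<le> \<delta> * (\<Sum>i<k. cmod (a i))"
    using norm_coeff_defect_le[OF ps k(1)]
    by (simp add: a_def coeff_pderiv del: of_nat_Suc)
  also have "\<dots> \<le> \<delta> * (real n * cmod (a k))"
    using sum_le \<delta>0 by (rule mult_left_mono)
  finally have "cmod (power_sum n z 1 * a k) \<le>
      \<delta> * (real n * cmod (a k)) + cmod (of_nat (Suc k) * a (Suc k))"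
    by (smt (verit) norm_triangle_ineq4 add_diff_cancel_left')
  then have "cmod (power_sum n z 1) * cmod (a k) \<le> (real n * (1 + \<delta>)) * cmod (a k)"
    using step by (simp add: norm_mult algebra_simps del: of_nat_Suc)
  then show ?thesis by (rule mult_right_le_imp_le) (use ak in auto)
qed

section \<open>The logarithmic derivative outside the unit disc\<close>

text \<open>
  This is \<open>P' / P\<close> in the coordinate \<open>y = 1 / x\<close>, extended by \<open>0\<close> to \<open>y = 0\<close>, that is, to
  \<open>x = \<infinity>\<close>; see \<open>recip_poly_outer\<close>.
\<close>
definition outer_log_deriv :: "nat \<Rightarrow> (nat \<Rightarrow> complex) \<Rightarrow> complex \<Rightarrow> complex" where
  "outer_log_deriv n z y = (\<Sum>j=1..n. y / (1 - y / z j))"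

lemma norm_div_less_1:
  assumes "cmod w \<ge> 1" "cmod y < 1"
  shows "cmod (y / w) \<le> cmod y" "1 - y / w \<noteq> 0"
proof -
  have "cmod y / cmod w \<le> cmod y / 1"
    using assms by (intro divide_left_mono) auto
  then show *: "cmod (y / w) \<le> cmod y" by (simp add: norm_divide)
  show "1 - y / w \<noteq> 0"
  proof
    assume "1 - y / w = 0"
    then have "cmod (y / w) = 1" by (metis norm_one right_minus_eq)
    with * assms show False by simp
  qed
qed

lemma recip_poly_outer:
  assumes z: "\<forall>j\<in>{1..n}. 1 \<le> cmod (z j)" and x: "cmod x > 1"
  shows "poly (recip_poly n z) x \<noteq> 0"
    and "poly (pderiv (recip_poly n z)) x = poly (recip_poly n z) x * outer_log_deriv n z (1 / x)"
proof -
  have ne: "z j * x \<noteq> 1" if "j \<in> {1..n}" for j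
  proof
    assume "z j * x = 1"
    then have "cmod (z j) * cmod x = 1" by (metis norm_mult norm_one)
    moreover have "1 * cmod x \<le> cmod (z j) * cmod x"
      using bspec[OF z that] by (intro mult_right_mono) auto
    ultimately show False using x by simp
  qed
  have "1 - z j * x \<noteq> 0" if "j \<in> {1..n}" for j using ne[OF that] by auto
  then show "poly (recip_poly n z) x \<noteq> 0"
    by (simp add: poly_recip_poly)
  have "- z j / (1 - z j * x) = (1 / x) / (1 - (1 / x) / z j)" if "j \<in> {1..n}" for j
  proof -
    have nz: "z j \<noteq> 0" "x \<noteq> 0" using bspec[OF z that] x by auto
    then have eq: "1 - (1 / x) / z j = - (1 - z j * x) / (z j * x)" by (simp add: field_simps)
    have cancel: "(1 / x) / (- u / (z j * x)) = - z j / u" for u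
      using nz by (cases "u = 0") (simp_all add: divide_simps)
    show ?thesis unfolding eq by (rule cancel [symmetric])
  qed
  then show "poly (pderiv (recip_poly n z)) x = poly (recip_poly n z) x * outer_log_deriv n z (1 / x)"
    unfolding outer_log_deriv_def using poly_pderiv_recip_poly[OF ne] by simp
qed

lemma outer_log_deriv_holomorphic:
  assumes z: "\<forall>j\<in>{1..n}. 1 \<le> cmod (z j)" and "r < 1"
  shows "outer_log_deriv n z holomorphic_on cball 0 r"
proof -
  have "z j \<noteq> 0" if "j \<in> {1..n}" for j using bspec[OF z that] by auto
  moreover have "1 - y / z j \<noteq> 0" if "j \<in> {1..n}" "y \<in> cball 0 r" for y j
    using norm_div_less_1(2)[OF bspec[OF z that(1)], of y] that \<open>r < 1\<close> by simp
  ultimately have "(\<lambda>y. \<Sum>j=1..n. y / (1 - y / z j)) holomorphic_on cball 0 r"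
    by (intro holomorphic_intros) auto
  then show ?thesis by (simp add: outer_log_deriv_def [abs_def])
qed

lemma norm_outer_log_deriv_le:
  assumes z: "\<forall>j\<in>{1..n}. 1 \<le> cmod (z j)" and y: "cmod y < 1"
  shows "cmod (outer_log_deriv n z y) \<le> n * (cmod y / (1 - cmod y))"
proof -
  have "cmod (\<Sum>j=1..n. y / (1 - y / z j)) \<le> (\<Sum>j=1..n. cmod y / (1 - cmod y))"
  proof (rule sum_norm_le)
    fix j assume "j \<in> {1..n}"
    then have "1 - cmod y \<le> 1 - cmod (y / z j)"
      using norm_div_less_1(1)[OF bspec[OF z] y] by simp
    also have "\<dots> \<le> cmod (1 - y / z j)"
      using norm_triangle_ineq2[of 1 "y / z j"] by simp
    finally show "cmod (y / (1 - y / z j)) \<le> cmod y / (1 - cmod y)"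
      using y unfolding norm_divide[of y] by (intro frac_le) auto
  qed
  then show ?thesis by (simp add: outer_log_deriv_def)
qed

lemma Re_inverse_one_minus_ge:
  assumes "cmod v < 1"
  shows "1 / 2 \<le> Re (1 / (1 - v))"
proof -
  have v: "(Re v)\<^sup>2 + (Im v)\<^sup>2 < 1"
    using assms power_strict_mono[of "cmod v" 1 2] by (simp add: cmod_power2)
  then have "Re v \<noteq> 1" by auto
  then have pos: "0 < (1 - Re v)\<^sup>2 + (Im v)\<^sup>2"
    by (intro add_pos_nonneg) auto
  have "Re (1 / (1 - v)) = (1 - Re v) / ((1 - Re v)\<^sup>2 + (Im v)\<^sup>2)"
    by (simp add: Re_divide)
  moreover have "(1 - Re v)\<^sup>2 + (Im v)\<^sup>2 \<le> 2 * (1 - Re v)"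
    using v by (simp add: power2_eq_square algebra_simps)
  ultimately show ?thesis using pos by (simp only: le_divide_eq) simp
qed

text \<open>
  The lower bound is free of cancellation because the map \<open>v \<mapsto> 1 / (1 - v)\<close> sends the unit disc into
  the half-plane of real part greater than \<open>1/2\<close>.
\<close>
lemma norm_outer_log_deriv_ge:
  assumes z: "\<forall>j\<in>{1..n}. 1 \<le> cmod (z j)" and y: "cmod y < 1"
  shows "n * cmod y / 2 \<le> cmod (outer_log_deriv n z y)"
proof -
  have "(\<Sum>j=1..n. 1 / 2) \<le> (\<Sum>j=1..n. Re (1 / (1 - y / z j)))"
  proof (intro sum_mono Re_inverse_one_minus_ge)
    fix j assume "j \<in> {1..n}"
    then show "cmod (y / z j) < 1" using norm_div_less_1(1)[OF bspec[OF z] y] y by fastforce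
  qed
  also have "\<dots> \<le> cmod (\<Sum>j=1..n. 1 / (1 - y / z j))"
    using complex_Re_le_cmod[of "\<Sum>j=1..n. 1 / (1 - y / z j)"] by (simp only: Re_sum)
  finally have "cmod y * (n / 2) \<le> cmod y * cmod (\<Sum>j=1..n. 1 / (1 - y / z j))"
    by (intro mult_left_mono) auto
  also have "\<dots> = cmod (outer_log_deriv n z y)"
    by (simp add: outer_log_deriv_def sum_distrib_left flip: norm_mult)
  finally show ?thesis by (simp add: mult.commute)
qed

section \<open>Lower bounds for the power sums\<close>

text \<open>
  The integer \<open>L\<close> balances two losses: \<open>exp (33 n / L)\<close> comes from leaving the unit disc and moving
  along an arc of length of order \<open>1 / L\<close>, and \<open>(4 (L + 2))\<^sup>L\<close> from multiplying \<open>L\<close> rotations,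
  in all but one of which the function is only bounded by \<open>n (L + 2)\<close>, to be compared with
  \<open>\<bar>s\<bar> \<ge> n / 4\<close>.
\<close>
proposition power_sums_lower_bound:
  assumes n: "n \<ge> 1" and L: "L \<ge> 2"
    and z: "\<forall>j\<in>{1..n}. 1 \<le> cmod (z j)"
    and ps: "\<forall>k\<in>{2..n+1}. cmod (power_sum n z k) \<le> \<delta>"
  shows "1 \<le> 4 * (real n)\<^sup>2 * \<delta> * exp (33 * real n / real L) * (4 * (real L + 2)) ^ L"
proof (rule ccontr)
  define \<eta> where "\<eta> = 4 * (real n)\<^sup>2 * \<delta> * exp (33 * real n / real L)"
  define R where "R = 1 + 1 / real L"
  define P where "P = recip_poly n z"
  define s where "s = - power_sum n z 1"
  \<comment> \<open>An upper bound for \<open>2 \<pi> R / L\<close>, one rotation step on the circle, since \<open>R \<le> 2\<close>.\<close>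
  define d where "d = 4 * pi / L"
  define e where "e = 2 * (real n)\<^sup>2 * \<delta> * R ^ n"
  assume "\<not> ?thesis"
  then have \<eta>_small: "\<eta> * (4 * (real L + 2)) ^ L < 1" by (simp add: \<eta>_def)
  have \<delta>0: "0 \<le> \<delta>"
    by (rule order_trans[OF norm_ge_zero ps[rule_format, of 2]]) (use n in auto)
  then have \<eta>0: "0 \<le> \<eta>" by (simp add: \<eta>_def)
  have "(16::real) ^ 2 \<le> 16 ^ L" using L by (intro power_increasing) auto
  also have "(16::real) ^ L \<le> (4 * (real L + 2)) ^ L" using L by (intro power_mono) auto
  finally have "\<eta> * 256 \<le> \<eta> * (4 * (real L + 2)) ^ L"
    using \<eta>0 by (intro mult_left_mono) auto
  with \<eta>_small have \<eta>256: "\<eta> \<le> 1 / 256" by simp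
  have "\<delta> * 1 \<le> \<delta> * (4 * (real n)\<^sup>2 * exp (33 * real n / real L))"
  proof (intro mult_left_mono \<delta>0)
    have "1 \<le> (real n)\<^sup>2" using n by simp
    then have "1 * 1 \<le> (4 * (real n)\<^sup>2) * exp (33 * real n / real L)" by (intro mult_mono) auto
    then show "1 \<le> 4 * (real n)\<^sup>2 * exp (33 * real n / real L)" by simp
  qed
  also have "\<dots> = \<eta>" by (simp add: \<eta>_def)
  finally have \<delta>1: "\<delta> \<le> 1" using \<eta>256 by simp
  have "cmod s \<le> real n * (1 + \<delta>)"
    using norm_first_power_sum_le[OF ps n] by (simp add: s_def)
  also have "\<dots> \<le> real n * 2" using \<delta>1 by (intro mult_left_mono) auto
  finally have s_le: "cmod s \<le> 2 * n" by simp
  have R: "1 < R" "R \<le> 3 / 2" using L by (simp_all add: R_def field_simps)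
  have e0: "0 \<le> e" using \<delta>0 R by (simp add: e_def)
  have d: "0 \<le> d" "d \<le> 8" "2 * pi * R / L \<le> d"
  proof -
    have "4 * pi \<le> 8 * L" using pi_less_4 L by linarith
    then show "0 \<le> d" "d \<le> 8" using L by (simp_all add: d_def field_simps)
    have "2 * pi * R \<le> 2 * pi * 2" using R by (intro mult_left_mono) auto
    then show "2 * pi * R / L \<le> d" using L by (simp add: d_def divide_right_mono)
  qed
  \<comment> \<open>The constant 33 is the sum of 1, from \<open>R\<^sup>n \<le> exp (n / L)\<close>, and 32, from
    \<open>\<bar>s\<bar> d \<le> 8 \<pi> n / L\<close> and \<open>\<pi> < 4\<close>.\<close>
  have \<eta>_ge: "2 * e * exp (cmod s * d) \<le> \<eta>"
  proof -
    have "R ^ n \<le> exp (1 / L) ^ n"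
      unfolding R_def by (intro power_mono exp_ge_add_one_self) auto
    then have Rn: "R ^ n \<le> exp (n / L)" by (simp flip: exp_of_nat_mult)
    have "cmod s * d \<le> (2 * n) * d" using s_le d by (intro mult_right_mono) auto
    also have "\<dots> \<le> 32 * real n / real L"
    proof -
      have "(8 * pi) * real n \<le> 32 * real n" using pi_less_4 by (intro mult_right_mono) auto
      then show ?thesis using L by (simp add: d_def divide_right_mono)
    qed
    finally have "exp (cmod s * d) \<le> exp (32 * real n / real L)" by simp
    then have "R ^ n * exp (cmod s * d) \<le> exp (n / L) * exp (32 * real n / real L)"
      using Rn R by (intro mult_mono) auto
    also have "\<dots> = exp (33 * real n / real L)"
      unfolding exp_add [symmetric] by (simp flip: add_divide_distrib)
    finally have "4 * (real n)\<^sup>2 * \<delta> * (R ^ n * exp (cmod s * d)) \<le> \<eta>"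
      unfolding \<eta>_def using \<delta>0 by (intro mult_left_mono) auto
    then show ?thesis by (simp add: e_def mult_ac)
  qed
  have "continuous_on (sphere 0 R) (\<lambda>x. cmod (poly P x))"
    by (intro continuous_intros)
  then obtain x0 where x0: "cmod x0 = R"
    and x0_max: "\<And>x. cmod x = R \<Longrightarrow> cmod (poly P x) \<le> cmod (poly P x0)"
    using continuous_attains_sup[of "sphere 0 R" "\<lambda>x. cmod (poly P x)"] R by auto
  define M where "M = cmod (poly P x0)"
  have P_ne: "poly P x \<noteq> 0" if "cmod x = R" for x
    unfolding P_def using recip_poly_outer(1)[OF z, of x] that R by simp
  have M0: "0 < M" using P_ne[OF x0] by (simp add: M_def)
  have defect: "cmod (poly (pderiv P) x - s * poly P x) \<le> e * M" if "cmod x \<le> R" for x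
    using norm_defect_le[OF ps n _ _ that, of M] x0_max R
    by (simp add: P_def M_def s_def e_def)
  \<comment> \<open>Near \<open>x0\<close> dividing the defect by \<open>P\<close> loses only the factor \<open>2 exp (\<bar>s\<bar> d)\<close>.\<close>
  have close: "cmod (outer_log_deriv n z y - s) \<le> \<eta>"
    if y: "cmod y = 1 / R" "cmod (1 / y - x0) \<le> d" for y
  proof -
    define x where "x = 1 / y"
    have x: "cmod x = R" "cmod (x - x0) \<le> d" "1 / x = y"
      using y by (simp_all add: x_def norm_divide)
    have "e * d * exp (cmod s * d) = (2 * e * exp (cmod s * d)) * (d / 2)" by simp
    also have "\<dots> \<le> (1 / 256) * (8 / 2)"
      using \<eta>_ge \<eta>256 d by (intro mult_mono) auto
    finally have "e * d * exp (cmod s * d) \<le> 1 / 2" by simp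
    then have ge: "M * exp (- (cmod s * d)) / 2 \<le> cmod (poly P x)"
      using x x0 e0 by (intro norm_poly_ge_near_max[OF defect]) (auto simp: M_def)
    have "poly (pderiv P) x - s * poly P x = poly P x * (outer_log_deriv n z y - s)"
      using recip_poly_outer(2)[OF z, of x] x R by (simp add: P_def algebra_simps)
    then have "cmod (poly P x) * cmod (outer_log_deriv n z y - s) \<le> e * M"
      using defect[of x] x by (simp add: norm_mult)
    moreover have "(M * exp (- (cmod s * d)) / 2) * cmod (outer_log_deriv n z y - s)
        \<le> cmod (poly P x) * cmod (outer_log_deriv n z y - s)"
      using ge by (intro mult_right_mono) auto
    ultimately have "M * (exp (- (cmod s * d)) / 2 * cmod (outer_log_deriv n z y - s)) \<le> M * e"
      by (simp add: mult_ac)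
    then have "exp (- (cmod s * d)) / 2 * cmod (outer_log_deriv n z y - s) \<le> e"
      using M0 by simp
    then have "cmod (outer_log_deriv n z y - s) \<le> 2 * e * exp (cmod s * d)"
      by (simp add: exp_minus field_simps)
    with \<eta>_ge show ?thesis by simp
  qed
  define y0 where "y0 = 1 / x0"
  have y0: "cmod y0 = 1 / R" "1 / y0 = x0" using x0 by (simp_all add: y0_def norm_divide)
  have s_ge: "n / 4 \<le> cmod s"
  proof -
    have "n * (1 / (3 / 2)) / 2 \<le> n * (1 / R) / 2"
      using R by (intro divide_right_mono mult_left_mono divide_left_mono) auto
    also have "\<dots> \<le> cmod (outer_log_deriv n z y0)"
      using norm_outer_log_deriv_ge[OF z, of y0] y0 R by simp
    finally have "n / 3 \<le> cmod (outer_log_deriv n z y0)" by simp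
    moreover have "cmod (outer_log_deriv n z y0 - s) \<le> 1 / 256"
      using close[of y0] y0 d \<eta>256 by simp
    moreover have "cmod (outer_log_deriv n z y0) - cmod s \<le> cmod (outer_log_deriv n z y0 - s)"
      by (rule norm_triangle_ineq2)
    ultimately have "n / 3 - 1 / 256 \<le> cmod s" by linarith
    moreover have "n / 4 \<le> n / 3 - 1 / 256" using n by simp
    ultimately show ?thesis by linarith
  qed
  define K where "K = real n * (real L + 2)"
  \<comment> \<open>The value at \<open>0\<close> is \<open>- s\<close>, since \<open>P' / P\<close> vanishes at infinity.\<close>
  have "cmod (outer_log_deriv n z 0 - s) ^ L \<le> \<eta> * K ^ (L - 1)"
  proof (rule rotation_product_bound[where r = "1 / R" and ?y0.0 = y0])
    have rR: "1 / R < 1" using R by simp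
    show "(\<lambda>y. outer_log_deriv n z y - s) holomorphic_on cball 0 (1 / R)"
      by (intro holomorphic_intros outer_log_deriv_holomorphic z rR)
    show "0 < 1 / R" "1 \<le> L" "cmod y0 = 1 / R" using R L y0 by auto
    show "cmod (outer_log_deriv n z y - s) \<le> K" if "cmod y = 1 / R" for y
    proof -
      have "(1 / R) / (1 - 1 / R) = L" using L by (simp add: R_def field_simps)
      then have "cmod (outer_log_deriv n z y) \<le> n * real L"
        using norm_outer_log_deriv_le[OF z, of y] that rR by simp
      moreover have "cmod (outer_log_deriv n z y - s) \<le> cmod (outer_log_deriv n z y) + cmod s"
        by (rule norm_triangle_ineq4)
      ultimately show ?thesis using s_le by (simp add: K_def algebra_simps)
    qed
    show "cmod (outer_log_deriv n z y - s) \<le> \<eta>"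
      if y: "cmod y = 1 / R" "cmod (y - y0) \<le> 2 * pi * (1 / R) / L" for y
    proof (rule close[OF y(1)])
      have ne: "y \<noteq> 0" "y0 \<noteq> 0" using y(1) y0 R by auto
      then have "1 / y - x0 = (y0 - y) / (y * y0)"
        unfolding y0(2) [symmetric] by (simp add: field_simps)
      then have "cmod (1 / y - x0) = cmod (y - y0) * R\<^sup>2"
        using y y0 R by (simp add: norm_divide norm_mult norm_minus_commute power2_eq_square)
      also have "\<dots> \<le> 2 * pi * (1 / R) / L * R\<^sup>2"
        using y(2) by (intro mult_right_mono) auto
      also have "\<dots> = 2 * pi * R / L" using R by (simp add: power2_eq_square)
      finally show "cmod (1 / y - x0) \<le> d" using d by linarith
    qed
  qed
  moreover have "(n / 4) ^ L \<le> cmod (outer_log_deriv n z 0 - s) ^ L"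
    using s_ge by (intro power_mono) (auto simp: outer_log_deriv_def)
  moreover have "\<eta> * K ^ (L - 1) \<le> \<eta> * K ^ L"
  proof (intro mult_left_mono power_increasing \<eta>0)
    have "1 * 1 \<le> real n * (real L + 2)" using n by (intro mult_mono) auto
    then show "1 \<le> K" by (simp add: K_def)
  qed auto
  ultimately have "(n / 4) ^ L \<le> \<eta> * K ^ L" by linarith
  also have "K = (n / 4) * (4 * (real L + 2))" by (simp add: K_def)
  also have "\<eta> * \<dots> ^ L = (\<eta> * (4 * (real L + 2)) ^ L) * (n / 4) ^ L"
    by (simp only: power_mult_distrib mult_ac)
  also have "\<dots> < 1 * (n / 4) ^ L"
    using \<eta>_small n by (intro mult_strict_right_mono) auto
  finally show False by simp
qed

lemma max_power_sum_ge:
  "\<forall>\<^sub>F n in sequentially. \<forall>z. (\<forall>j\<in>{1..n}. cmod (z j) \<ge> 1) \<longrightarrow>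
     max_power_sum n z \<ge> exp (- (sqrt (real n) * ln (real n)))"
proof -
  have "\<forall>\<^sub>F n in sequentially. 4 * (real n)\<^sup>2 * exp (33 * sqrt (real n)) *
      (4 * (sqrt (real n) + 3)) powr (sqrt (real n) + 1) \<le> exp (sqrt (real n) * ln (real n))"
    by real_asymp
  then show ?thesis
    using eventually_ge_at_top[of 2]
  proof eventually_elim
    case (elim n)
    show ?case
    proof (intro allI impI)
      fix z :: "nat \<Rightarrow> complex"
      assume z: "\<forall>j\<in>{1..n}. cmod (z j) \<ge> 1"
      define \<delta> where "\<delta> = max_power_sum n z"
      have ps: "\<forall>k\<in>{2..n+1}. cmod (power_sum n z k) \<le> \<delta>"
        unfolding \<delta>_def max_power_sum_def by (intro ballI Max_ge) auto
      define L where "L = nat \<lceil>sqrt (real n)\<rceil>"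
      have "1 < sqrt (real n)" using elim by simp
      then have L: "sqrt (real n) \<le> L" "L \<le> sqrt (real n) + 1" "L \<ge> 2"
        unfolding L_def by linarith+
      have \<delta>0: "0 \<le> \<delta>"
        by (rule order_trans[OF norm_ge_zero ps[rule_format, of 2]]) (use elim in auto)
      have "real n = sqrt (real n) * sqrt (real n)" by simp
      also have "\<dots> \<le> sqrt (real n) * L" using L by (intro mult_left_mono) auto
      finally have nL: "33 * real n / real L \<le> 33 * sqrt (real n)"
        using L by (simp add: field_simps)
      have "(4 * (real L + 2)) ^ L = (4 * (real L + 2)) powr L"
        using L by (simp add: powr_realpow)
      also have "\<dots> \<le> (4 * (sqrt (real n) + 3)) powr L"
        using L by (intro powr_mono2) auto
      also have "\<dots> \<le> (4 * (sqrt (real n) + 3)) powr (sqrt (real n) + 1)"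
        using L by (intro powr_mono) auto
      finally have pow: "(4 * (real L + 2)) ^ L \<le> (4 * (sqrt (real n) + 3)) powr (sqrt (real n) + 1)" .
      have "1 \<le> 4 * (real n)\<^sup>2 * \<delta> * exp (33 * real n / real L) * (4 * (real L + 2)) ^ L"
        by (rule power_sums_lower_bound[OF _ L(3) z ps]) (use elim in auto)
      also have "\<dots> \<le> 4 * (real n)\<^sup>2 * \<delta> * exp (33 * sqrt (real n)) *
          (4 * (sqrt (real n) + 3)) powr (sqrt (real n) + 1)"
        using nL pow \<delta>0 by (intro mult_mono) auto
      also have "\<dots> = \<delta> * (4 * (real n)\<^sup>2 * exp (33 * sqrt (real n)) *
          (4 * (sqrt (real n) + 3)) powr (sqrt (real n) + 1))" by simp
      also have "\<dots> \<le> \<delta> * exp (sqrt (real n) * ln (real n))"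
        using elim(1) \<delta>0 by (rule mult_left_mono)
      finally show "exp (- (sqrt (real n) * ln (real n))) \<le> max_power_sum n z"
        by (simp add: \<delta>_def exp_minus field_simps)
    qed
  qed
qed

theorem corollary3p2:
  shows "(\<forall>\<epsilon>::real. \<epsilon> > 0 \<longrightarrow>
            (\<exists>N::nat. \<forall>n\<ge>N. \<forall>z::nat \<Rightarrow> complex.
               (\<forall>j\<in>{1..n}. cmod (z j) \<ge> 1) \<longrightarrow>
               max_power_sum n z \<ge>
                 1 / real n * exp (- (sqrt (real n) * (ln (real n) + ln (2 / ln 2) + \<epsilon>)))))
       \<and>
         (\<exists>\<eta>::nat \<Rightarrow> real. \<eta> \<longlonglongrightarrow> 0 \<and>
            (\<exists>N::nat. \<forall>n\<ge>N. \<forall>z::nat \<Rightarrow> complex.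
               (\<forall>j\<in>{1..n}. cmod (z j) \<ge> 1) \<longrightarrow>
               max_power_sum n z \<ge> exp (- ((1 + \<eta> n) * sqrt (real n) * ln (real n)))))"
proof (intro conjI allI impI)
  obtain N where N: "exp (- (sqrt (real n) * ln (real n))) \<le> max_power_sum n z"
    if "n \<ge> N" "\<forall>j\<in>{1..n}. cmod (z j) \<ge> 1" for n z
    using max_power_sum_ge unfolding eventually_sequentially by blast
  show "\<exists>\<eta>::nat \<Rightarrow> real. \<eta> \<longlonglongrightarrow> 0 \<and>
            (\<exists>N::nat. \<forall>n\<ge>N. \<forall>z::nat \<Rightarrow> complex.
               (\<forall>j\<in>{1..n}. cmod (z j) \<ge> 1) \<longrightarrow>
               max_power_sum n z \<ge> exp (- ((1 + \<eta> n) * sqrt (real n) * ln (real n))))"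
    using N by (intro exI[of _ "\<lambda>_. 0"] conjI exI[of _ N]) auto
  fix \<epsilon> :: real assume "\<epsilon> > 0"
  have "0 \<le> ln (2 / ln 2 :: real)"
    using ln_2_less_1 by (intro ln_ge_zero) (simp add: field_simps)
  show "\<exists>N::nat. \<forall>n\<ge>N. \<forall>z::nat \<Rightarrow> complex.
               (\<forall>j\<in>{1..n}. cmod (z j) \<ge> 1) \<longrightarrow>
               max_power_sum n z \<ge>
                 1 / real n * exp (- (sqrt (real n) * (ln (real n) + ln (2 / ln 2) + \<epsilon>)))"
  proof (intro exI[of _ "max N 1"] allI impI)
    fix n z assume n: "n \<ge> max N 1" and z: "\<forall>j\<in>{1..n}. cmod (z j) \<ge> 1"
    have "1 / real n * exp (- (sqrt (real n) * (ln (real n) + ln (2 / ln 2) + \<epsilon>)))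
        \<le> 1 * exp (- (sqrt (real n) * ln (real n)))"
    proof (intro mult_mono)
      have "sqrt (real n) * ln (real n) \<le> sqrt (real n) * (ln (real n) + ln (2 / ln 2) + \<epsilon>)"
        using \<open>\<epsilon> > 0\<close> \<open>0 \<le> ln (2 / ln 2 :: real)\<close> by (intro mult_left_mono) auto
      then show "exp (- (sqrt (real n) * (ln (real n) + ln (2 / ln 2) + \<epsilon>)))
          \<le> exp (- (sqrt (real n) * ln (real n)))" by simp
    qed (use n in auto)
    also have "\<dots> \<le> max_power_sum n z" using N[OF _ z] n by simp
    finally show "max_power_sum n z \<ge>
        1 / real n * exp (- (sqrt (real n) * (ln (real n) + ln (2 / ln 2) + \<epsilon>)))" .
  qed
qed

end
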